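(* Let $E_9$ be the formula (the last expansion along the abbreviation scheme $U_0$) defined in the context, let $E_9(x_{19};x_{18})$ be the word obtained from $E_9$ by simultaneously replacing every occurrence of $x$ by $x_{19}$ and every occurrence of $y$ by $x_{18}$, and let $$\varphi\equiv(\forall x_{18}\neg(\exists x_{19}\,E_9(x_{19};x_{18}))),$$ a word over the alphabet $\mathcal{A}=\{x_i : i\in\mathbb{N}\}\cup\{\in,=,\neg,\to,\leftrightarrow,\wedge,\vee,\exists,\forall,(,)\}$. Then $|\varphi|=494$, $|\varphi|_{\neg}=1$, and for every digraph $D$: $D\models\varphi$ if and only if Cantor's theorem holds in $D$.
   Context: $\mathbb{N}=\{1,2,\dots\}$. For a word $u$, $|u|$ is its length (number of letters) and $|u|_{\neg}$ is the number of occurrences of the letter $\neg$ in it. FORMULAS. Set variables are $x_1,x_2,\dots$ and "new variables" $\mathcal{V}=\{x,y,z,a,b,c,y_1,y_2,\dots\}$; every variable and every symbol $\in,=,\neg,\to,\leftrightarrow,\wedge,\vee,\exists,\forall,(,)$ is a single letter. Formulas are the words built from atomic formulas $(\alpha\in\alpha')$ and $(\alpha=\alpha')$ (length 5; $\alpha,\alpha'$ variables) by: $\neg u$, $(u\to v)$, $(u\leftrightarrow v)$, $(u\wedge v)$, $(u\vee v)$, $(\exists x_k u)$, $(\forall x_k u)$. ZF formulas are the formulas without new variables. A sentence is a formula without free occurrences of variables. DIGRAPHS AND SATISFACTION. A digraph is $D=\langle V,E\rangle$ with $V$ a nonempty set and $E\subseteq V\times V$; $uEv$ means $\langle u,v\rangle\in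 E$. $D\models_f u$, for $f$ a map from the variables to $V$, is the usual first-order satisfaction, with $(\alpha\in\alpha')$ read as $f(\alpha)Ef(\alpha')$, $(\alpha=\alpha')$ as $f(\alpha)=f(\alpha')$, and quantifiers ranging over $V$. For sentences this does not depend on $f$ and one writes $D\models u$. THE FORMULA $E_9$. The scheme $U_0=\langle\Phi_1,\dots,\Phi_9\rangle$ consists of the shortcuts (predicate $\equiv$ right-hand side): $\Phi_1$: $\mathrm{SUS}(x;y)\equiv(\forall x_1((x_1\in x)\to(x_1\in y)))$; $\Phi_2$: $\mathrm{SI}(x;y)\equiv(\forall x_2((x_2\in x)\leftrightarrow(x_2=y)))$; $\Phi_3$: $\mathrm{SIN}(x;y)\equiv(\forall x_3(\mathrm{SI}(x_3;y)\leftrightarrow(x_3=x)))$; $\Phi_4$: $\mathrm{DO}(x;y;z)\equiv(\forall x_4((x_4\in x)\leftrightarrow((x_4=y)\vee(x_4=z))))$; $\Phi_5$: $\mathrm{DOU}(x;y;z)\equiv(\forall x_5(\mathrm{DO}(x_5;y;z)\leftrightarrow(x_5=x)))$; $\Phi_6$: $\mathrm{OPA}(x;y;z)\equiv(\exists x_6(\exists x_7(\mathrm{DOU}(x;x_6;x_7)\wedge(\mathrm{SIN}(x_6;y)\wedge\mathrm{DOU}(x_7;y;z)))))$; $\Phi_7$: $\mathrm{REL}(x;y)\equiv(\forall x_8((x_8\in x)\to(\exists x_9(\exists x_{10}(\mathrm{OPA}(x_8;x_9;x_{10})\wedge((x_9\in y)\wedge\mathrm{SUS}(x_{10};y)))))))$;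 $\Phi_8$: $\mathrm{FUN}(x;y)\equiv(\mathrm{REL}(x;y)\wedge(\forall x_{11}((x_{11}\in y)\to(\exists x_{12}(\forall x_{13}((x_{13}=x_{12})\leftrightarrow((x_{13}\in x)\wedge(\exists x_{14}\mathrm{OPA}(x_{13};x_{11};x_{14})))))))))$; $\Phi_9$: $\mathrm{SUR}(x;y)\equiv(\mathrm{FUN}(x;y)\wedge(\forall x_{15}(\mathrm{SUS}(x_{15};y)\to(\exists x_{16}(\exists x_{17}((x_{16}\in x)\wedge\mathrm{OPA}(x_{16};x_{17};x_{15})))))))$. The expansions $E_1,\dots,E_9$ are predicate-free formulas defined recursively: $E_i$ is obtained from the right-hand side of $\Phi_i$ by replacing each predicate atom $q(\alpha_1;\dots;\alpha_m)$, where $q$ is the predicate of $\Phi_k$, $k<i$, with left-hand side $q(\beta_1;\dots;\beta_m)$, by the word obtained from $E_k$ by simultaneously replacing all occurrences of $\beta_1,\dots,\beta_m$ by $\alpha_1,\dots,\alpha_m$. CANTOR'S THEOREM IN A DIGRAPH. Let $D=\langle V,E\rangle$ be a digraph and $N(u)=\{v\in V: vEu\}$; elements of $N(u)$ are the $D$-elements of $u$. For vertices: $u$ is a $D$-subset of $v$ ($u\subset_D v$) if $N(u)\subseteq N(v)$; $u$ is the singleton $\{v\}_D$ if $u$ is the only vertex with $N(u)=\{v\}$; $u$ is the doubleton $\{v,w\}_D$ if $u$ is the only vertex with $N(u)=\{v,w\}$; $u$ is an ordered pair $\langle v,w\rangle_D$ if $u=\{\{v\}_D,\{v,w\}_D\}_D$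 (i.e. there are vertices $s,t$ such that $s$ is the singleton $\{v\}_D$, $t$ is the doubleton $\{v,w\}_D$ and $u$ is the doubleton $\{s,t\}_D$). $u$ is a $D$-relation from $v$ to $P(v)$ if every $D$-element of $u$ is an ordered pair $\langle w,w'\rangle_D$ with $wEv$ and $w'\subset_D v$. $u$ is a $D$-function from $v$ to $P(v)$ if it is a $D$-relation from $v$ to $P(v)$ and for every $D$-element $w$ of $v$ there is exactly one ordered pair $\langle w,w'\rangle_D$ that is a $D$-element of $u$. $u$ is a $D$-surjection from $v$ to $P(v)$ if it is a $D$-function from $v$ to $P(v)$ and for every $w'\subset_D v$ there is at least one ordered pair $\langle w,w'\rangle_D$ that is a $D$-element of $u$. Cantor's theorem holds in $D$ ($D$ is Cantor) if for no vertex $u\in V$ there exists a vertex $v\in V$ that is a $D$-surjection from $u$ to $P(u)$. *)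

theory Defs
  imports "Graph_Theory.Pair_Digraph"
begin

section \<open>Words and formulas\<close>

text \<open>
  \<open>X i\<close> is the set variable $x_i$ with $i \ge 1$; \<open>X 0\<close> has no counterpart on paper and does not
  belong to the alphabet below. The other constructors are the new variables $x$, $y$, $z$, $a$, $b$,
  $c$, $y_1$, $y_2$, \<open>\<dots>\<close>
\<close>

datatype var = X nat | Vx | Vy | Vz | Va | Vb | Vc | Y nat

datatype predicate = SUS | SI | SIN | DO | DOU | OPA | REL | FUN | SUR

text \<open>
  A predicate atom $q(\alpha_1;\dots;\alpha_m)$ is represented by a single auxiliary letter
  \<open>Atom q [\<alpha>\<^sub>1, \<dots>, \<alpha>\<^sub>m]\<close>. It occurs in right-hand sides of shortcuts only, never in formulas.
\<close>

datatype letter =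
    Var var | Elem | Equal | Neg | Imp | Iff | Conj | Disj | Exists | Forall | Open | Close
  | Atom predicate "var list"

type_synonym word = "letter list"

definition zf_alphabet :: "letter set" where
  "zf_alphabet = {Var (X i) | i. i \<ge> 1} \<union>
     {Elem, Equal, Neg, Imp, Iff, Conj, Disj, Exists, Forall, Open, Close}"

abbreviation w_elem :: "var \<Rightarrow> var \<Rightarrow> word" (infix \<open>\<^bold>\<in>\<close> 90) where
  "a \<^bold>\<in> b \<equiv> [Open, Var a, Elem, Var b, Close]"
abbreviation w_equal :: "var \<Rightarrow> var \<Rightarrow> word" (infix \<open>\<^bold>=\<close> 90) where
  "a \<^bold>= b \<equiv> [Open, Var a, Equal, Var b, Close]"
abbreviation w_neg :: "word \<Rightarrow> word" (\<open>\<^bold>\<not> _\<close> [85] 85) where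
  "\<^bold>\<not> u \<equiv> [Neg] @ u"
abbreviation w_imp :: "word \<Rightarrow> word \<Rightarrow> word" (infixr \<open>\<^bold>\<rightarrow>\<close> 70) where
  "u \<^bold>\<rightarrow> v \<equiv> [Open] @ u @ [Imp] @ v @ [Close]"
abbreviation w_iff :: "word \<Rightarrow> word \<Rightarrow> word" (infix \<open>\<^bold>\<leftrightarrow>\<close> 70) where
  "u \<^bold>\<leftrightarrow> v \<equiv> [Open] @ u @ [Iff] @ v @ [Close]"
abbreviation w_conj :: "word \<Rightarrow> word \<Rightarrow> word" (infixr \<open>\<^bold>\<and>\<close> 80) where
  "u \<^bold>\<and> v \<equiv> [Open] @ u @ [Conj] @ v @ [Close]"
abbreviation w_disj :: "word \<Rightarrow> word \<Rightarrow> word" (infixr \<open>\<^bold>\<or>\<close> 75) where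
  "u \<^bold>\<or> v \<equiv> [Open] @ u @ [Disj] @ v @ [Close]"
abbreviation w_exists :: "nat \<Rightarrow> word \<Rightarrow> word" (\<open>\<^bold>\<exists>_ _\<close> [1000, 85] 85) where
  "\<^bold>\<exists>k u \<equiv> [Open, Exists, Var (X k)] @ u @ [Close]"
abbreviation w_forall :: "nat \<Rightarrow> word \<Rightarrow> word" (\<open>\<^bold>\<forall>_ _\<close> [1000, 85] 85) where
  "\<^bold>\<forall>k u \<equiv> [Open, Forall, Var (X k)] @ u @ [Close]"

text \<open>
  Formulas are the words in the range of \<open>word_of\<close>; the trees of type \<open>fm\<close> record how a formula is
  built and serve to define satisfaction by recursion.
\<close>

datatype fm =
    FElem var var | FEqual var var | FNeg fm
  | FImp fm fm | FIff fm fm | FConj fm fm | FDisj fm fm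
  | FExists nat fm | FForall nat fm

primrec word_of :: "fm \<Rightarrow> word" where
  "word_of (FElem a b) = a \<^bold>\<in> b"
| "word_of (FEqual a b) = a \<^bold>= b"
| "word_of (FNeg p) = \<^bold>\<not> (word_of p)"
| "word_of (FImp p q) = word_of p \<^bold>\<rightarrow> word_of q"
| "word_of (FIff p q) = word_of p \<^bold>\<leftrightarrow> word_of q"
| "word_of (FConj p q) = word_of p \<^bold>\<and> word_of q"
| "word_of (FDisj p q) = word_of p \<^bold>\<or> word_of q"
| "word_of (FExists k p) = \<^bold>\<exists>k (word_of p)"
| "word_of (FForall k p) = \<^bold>\<forall>k (word_of p)"

primrec sat :: "'a pair_pre_digraph \<Rightarrow> (var \<Rightarrow> 'a) \<Rightarrow> fm \<Rightarrow> bool" where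
  "sat D f (FElem a b) \<longleftrightarrow> (f a, f b) \<in> parcs D"
| "sat D f (FEqual a b) \<longleftrightarrow> f a = f b"
| "sat D f (FNeg p) \<longleftrightarrow> \<not> sat D f p"
| "sat D f (FImp p q) \<longleftrightarrow> (sat D f p \<longrightarrow> sat D f q)"
| "sat D f (FIff p q) \<longleftrightarrow> (sat D f p \<longleftrightarrow> sat D f q)"
| "sat D f (FConj p q) \<longleftrightarrow> (sat D f p \<and> sat D f q)"
| "sat D f (FDisj p q) \<longleftrightarrow> (sat D f p \<or> sat D f q)"
| "sat D f (FExists k p) \<longleftrightarrow> (\<exists>v \<in> pverts D. sat D (f(X k := v)) p)"
| "sat D f (FForall k p) \<longleftrightarrow> (\<forall>v \<in> pverts D. sat D (f(X k := v)) p)"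

text \<open>Unique readability: \<open>satisfies\<close> below does not depend on the choice of the tree.\<close>

lemma word_of_append_neq:
  assumes "l \<noteq> Neg" "l \<noteq> Open"
  shows "word_of p @ r \<noteq> l # s" "l # s \<noteq> word_of p @ r"
  using assms by (cases p; auto)+

lemma word_of_append_inject: "word_of p @ r = word_of q @ s \<Longrightarrow> p = q \<and> r = s"
proof (induction p arbitrary: q r s)
  case (FElem a b)
  then show ?case
    by (cases q) (simp_all add: word_of_append_neq)
next
  case (FEqual a b)
  then show ?case
    by (cases q) (simp_all add: word_of_append_neq)
next
  case (FNeg p)
  then show ?case
    by (cases q) simp_all
next
  case (FImp p1 p2)
  have "word_of p1 @ u = word_of q' @ v \<longleftrightarrow> p1 = q' \<and> u = v"
    "word_of p2 @ u = word_of q' @ v \<longleftrightarrow> p2 = q' \<and> u = v" for q' u v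
    using FImp.IH(1)[of u q' v] FImp.IH(2)[of u q' v] by auto
  with FImp.prems show ?case
    by (cases q) (simp_all add: word_of_append_neq)
next
  case (FIff p1 p2)
  have "word_of p1 @ u = word_of q' @ v \<longleftrightarrow> p1 = q' \<and> u = v"
    "word_of p2 @ u = word_of q' @ v \<longleftrightarrow> p2 = q' \<and> u = v" for q' u v
    using FIff.IH(1)[of u q' v] FIff.IH(2)[of u q' v] by auto
  with FIff.prems show ?case
    by (cases q) (simp_all add: word_of_append_neq)
next
  case (FConj p1 p2)
  have "word_of p1 @ u = word_of q' @ v \<longleftrightarrow> p1 = q' \<and> u = v"
    "word_of p2 @ u = word_of q' @ v \<longleftrightarrow> p2 = q' \<and> u = v" for q' u v
    using FConj.IH(1)[of u q' v] FConj.IH(2)[of u q' v] by auto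
  with FConj.prems show ?case
    by (cases q) (simp_all add: word_of_append_neq)
next
  case (FDisj p1 p2)
  have "word_of p1 @ u = word_of q' @ v \<longleftrightarrow> p1 = q' \<and> u = v"
    "word_of p2 @ u = word_of q' @ v \<longleftrightarrow> p2 = q' \<and> u = v" for q' u v
    using FDisj.IH(1)[of u q' v] FDisj.IH(2)[of u q' v] by auto
  with FDisj.prems show ?case
    by (cases q) (simp_all add: word_of_append_neq)
next
  case (FExists k p)
  have "word_of p @ u = word_of q' @ v \<longleftrightarrow> p = q' \<and> u = v" for q' u v
    using FExists.IH[of u q' v] by auto
  with FExists.prems show ?case
    by (cases q) (simp_all add: word_of_append_neq)
next
  case (FForall k p)
  have "word_of p @ u = word_of q' @ v \<longleftrightarrow> p = q' \<and> u = v" for q' u v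
    using FForall.IH[of u q' v] by auto
  with FForall.prems show ?case
    by (cases q) (simp_all add: word_of_append_neq)
qed

lemma inj_word_of: "inj word_of"
  using word_of_append_inject[of _ "[]" _ "[]"] by (auto intro!: injI)

definition satisfies :: "'a pair_pre_digraph \<Rightarrow> (var \<Rightarrow> 'a) \<Rightarrow> word \<Rightarrow> bool" where
  "satisfies D f u \<longleftrightarrow> (\<exists>p. word_of p = u \<and> sat D f p)"

text \<open>
  For a sentence \<open>u\<close>, satisfaction is the same for all maps \<open>f\<close> into the vertex set (see
  \<open>sat_cong_free\<close>).
\<close>

definition models :: "'a pair_pre_digraph \<Rightarrow> word \<Rightarrow> bool" where
  "models D u \<longleftrightarrow> (\<forall>f. range f \<subseteq> pverts D \<longrightarrow> satisfies D f u)"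

primrec free_vars :: "fm \<Rightarrow> var set" where
  "free_vars (FElem a b) = {a, b}"
| "free_vars (FEqual a b) = {a, b}"
| "free_vars (FNeg p) = free_vars p"
| "free_vars (FImp p q) = free_vars p \<union> free_vars q"
| "free_vars (FIff p q) = free_vars p \<union> free_vars q"
| "free_vars (FConj p q) = free_vars p \<union> free_vars q"
| "free_vars (FDisj p q) = free_vars p \<union> free_vars q"
| "free_vars (FExists k p) = free_vars p - {X k}"
| "free_vars (FForall k p) = free_vars p - {X k}"

lemma sat_cong_free: "(\<And>a. a \<in> free_vars p \<Longrightarrow> f a = g a) \<Longrightarrow> sat D f p \<longleftrightarrow> sat D g p"
proof (induction p arbitrary: f g)
  case (FExists k p)
  have "sat D (f(X k := v)) p \<longleftrightarrow> sat D (g(X k := v)) p" for v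
    by (rule FExists.IH) (use FExists.prems in auto)
  then show ?case by simp
next
  case (FForall k p)
  have "sat D (f(X k := v)) p \<longleftrightarrow> sat D (g(X k := v)) p" for v
    by (rule FForall.IH) (use FForall.prems in auto)
  then show ?case by simp
next
  case (FImp p q) then show ?case by (metis UnCI free_vars.simps(4) sat.simps(4))
next
  case (FIff p q) then show ?case by (metis UnCI free_vars.simps(5) sat.simps(5))
next
  case (FConj p q) then show ?case by (metis UnCI free_vars.simps(6) sat.simps(6))
next
  case (FDisj p q) then show ?case by (metis UnCI free_vars.simps(7) sat.simps(7))
next
  case (FNeg p) then show ?case by (metis free_vars.simps(3) sat.simps(3))
qed auto


section \<open>Abbreviation schemes and their expansions\<close>

text \<open>\<open>Shortcut q [\<beta>\<^sub>1, \<dots>, \<beta>\<^sub>m] u\<close> stands for $q(\beta_1;\dots;\beta_m) \equiv u$.\<close>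

datatype shortcut = Shortcut predicate "var list" word

primrec subst_var :: "(var \<times> var) list \<Rightarrow> var \<Rightarrow> var" where
  "subst_var [] v = v"
| "subst_var (s # ss) v = (if v = fst s then snd s else subst_var ss v)"

fun replace_letter :: "(var \<times> var) list \<Rightarrow> letter \<Rightarrow> letter" where
  "replace_letter ss (Var v) = Var (subst_var ss v)"
| "replace_letter ss l = l"

text \<open>
  Simultaneous replacement of all occurrences (bound ones included) of the variables \<open>bs\<close> by the
  variables \<open>as\<close>. It is applied to words without predicate atoms only.
\<close>

definition replace :: "var list \<Rightarrow> var list \<Rightarrow> word \<Rightarrow> word" where
  "replace bs as u = map (replace_letter (zip bs as)) u"

text \<open>
  An environment assigns to the predicates introduced so far their parameters and expansions.
  Each shortcut is expanded with respect to the ones preceding it in the scheme.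
\<close>

type_synonym env = "predicate \<rightharpoonup> var list \<times> word"

fun expand_letter :: "env \<Rightarrow> letter \<Rightarrow> word" where
  "expand_letter \<rho> (Atom q as) =
     (case \<rho> q of Some (bs, u) \<Rightarrow> replace bs as u | None \<Rightarrow> [Atom q as])"
| "expand_letter \<rho> l = [l]"

definition expand :: "env \<Rightarrow> word \<Rightarrow> word" where
  "expand \<rho> u = concat (map (expand_letter \<rho>) u)"

fun expansions_from :: "env \<Rightarrow> shortcut list \<Rightarrow> word list" where
  "expansions_from \<rho> [] = []"
| "expansions_from \<rho> (Shortcut q bs u # \<Phi>s) =
     expand \<rho> u # expansions_from (\<rho>(q \<mapsto> (bs, expand \<rho> u))) \<Phi>s"

abbreviation expansions :: "shortcut list \<Rightarrow> word list" where
  "expansions \<equiv> expansions_from Map.empty"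

abbreviation atom :: "predicate \<Rightarrow> var list \<Rightarrow> word" where
  "atom q as \<equiv> [Atom q as]"

definition U0 :: "shortcut list" where
  "U0 =
   [Shortcut SUS [Vx, Vy] (\<^bold>\<forall>1 (X 1 \<^bold>\<in> Vx \<^bold>\<rightarrow> X 1 \<^bold>\<in> Vy)),
    Shortcut SI [Vx, Vy] (\<^bold>\<forall>2 (X 2 \<^bold>\<in> Vx \<^bold>\<leftrightarrow> X 2 \<^bold>= Vy)),
    Shortcut SIN [Vx, Vy] (\<^bold>\<forall>3 (atom SI [X 3, Vy] \<^bold>\<leftrightarrow> X 3 \<^bold>= Vx)),
    Shortcut DO [Vx, Vy, Vz] (\<^bold>\<forall>4 (X 4 \<^bold>\<in> Vx \<^bold>\<leftrightarrow> (X 4 \<^bold>= Vy \<^bold>\<or> X 4 \<^bold>= Vz))),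
    Shortcut DOU [Vx, Vy, Vz] (\<^bold>\<forall>5 (atom DO [X 5, Vy, Vz] \<^bold>\<leftrightarrow> X 5 \<^bold>= Vx)),
    Shortcut OPA [Vx, Vy, Vz]
      (\<^bold>\<exists>6 (\<^bold>\<exists>7 (atom DOU [Vx, X 6, X 7] \<^bold>\<and> (atom SIN [X 6, Vy] \<^bold>\<and> atom DOU [X 7, Vy, Vz])))),
    Shortcut REL [Vx, Vy]
      (\<^bold>\<forall>8 (X 8 \<^bold>\<in> Vx \<^bold>\<rightarrow>
        (\<^bold>\<exists>9 (\<^bold>\<exists>10 (atom OPA [X 8, X 9, X 10] \<^bold>\<and> (X 9 \<^bold>\<in> Vy \<^bold>\<and> atom SUS [X 10, Vy])))))),
    Shortcut FUN [Vx, Vy]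
      (atom REL [Vx, Vy] \<^bold>\<and>
        (\<^bold>\<forall>11 (X 11 \<^bold>\<in> Vy \<^bold>\<rightarrow>
          (\<^bold>\<exists>12 (\<^bold>\<forall>13 (X 13 \<^bold>= X 12 \<^bold>\<leftrightarrow>
            (X 13 \<^bold>\<in> Vx \<^bold>\<and> (\<^bold>\<exists>14 (atom OPA [X 13, X 11, X 14]))))))))),
    Shortcut SUR [Vx, Vy]
      (atom FUN [Vx, Vy] \<^bold>\<and>
        (\<^bold>\<forall>15 (atom SUS [X 15, Vy] \<^bold>\<rightarrow>
          (\<^bold>\<exists>16 (\<^bold>\<exists>17 (X 16 \<^bold>\<in> Vx \<^bold>\<and> atom OPA [X 16, X 17, X 15]))))))]"

definition E9 :: word where
  "E9 = last (expansions U0)"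

definition cantor_formula :: word where
  "cantor_formula = \<^bold>\<forall>18 (\<^bold>\<not> (\<^bold>\<exists>19 (replace [Vx, Vy] [X 19, X 18] E9)))"


section \<open>Cantor's theorem in a digraph\<close>

definition is_digraph :: "'a pair_pre_digraph \<Rightarrow> bool" where
  "is_digraph D \<longleftrightarrow> pair_wf_digraph D \<and> pverts D \<noteq> {}"

definition elems :: "'a pair_pre_digraph \<Rightarrow> 'a \<Rightarrow> 'a set" where
  "elems D u = {v \<in> pverts D. (v, u) \<in> parcs D}"

definition d_subset :: "'a pair_pre_digraph \<Rightarrow> 'a \<Rightarrow> 'a \<Rightarrow> bool" where
  "d_subset D u v \<longleftrightarrow> elems D u \<subseteq> elems D v"

definition d_singleton :: "'a pair_pre_digraph \<Rightarrow> 'a \<Rightarrow> 'a \<Rightarrow> bool" where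
  "d_singleton D u v \<longleftrightarrow>
     u \<in> pverts D \<and> elems D u = {v} \<and> (\<forall>u' \<in> pverts D. elems D u' = {v} \<longrightarrow> u' = u)"

definition d_doubleton :: "'a pair_pre_digraph \<Rightarrow> 'a \<Rightarrow> 'a \<Rightarrow> 'a \<Rightarrow> bool" where
  "d_doubleton D u v w \<longleftrightarrow>
     u \<in> pverts D \<and> elems D u = {v, w} \<and> (\<forall>u' \<in> pverts D. elems D u' = {v, w} \<longrightarrow> u' = u)"

definition d_pair :: "'a pair_pre_digraph \<Rightarrow> 'a \<Rightarrow> 'a \<Rightarrow> 'a \<Rightarrow> bool" where
  "d_pair D u v w \<longleftrightarrow>
     (\<exists>s \<in> pverts D. \<exists>t \<in> pverts D. d_singleton D s v \<and> d_doubleton D t v w \<and> d_doubleton D u s t)"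

text \<open>
  In the following three definitions, \<open>u\<close> is the relation, function or surjection, from \<open>v\<close> to the
  (not necessarily existing) power set of \<open>v\<close>.
\<close>

definition d_relation :: "'a pair_pre_digraph \<Rightarrow> 'a \<Rightarrow> 'a \<Rightarrow> bool" where
  "d_relation D u v \<longleftrightarrow>
     (\<forall>p \<in> elems D u. \<exists>w \<in> pverts D. \<exists>w' \<in> pverts D.
        d_pair D p w w' \<and> (w, v) \<in> parcs D \<and> d_subset D w' v)"

definition d_function :: "'a pair_pre_digraph \<Rightarrow> 'a \<Rightarrow> 'a \<Rightarrow> bool" where
  "d_function D u v \<longleftrightarrow> d_relation D u v \<and>
     (\<forall>w \<in> elems D v. \<exists>!p. p \<in> elems D u \<and> (\<exists>w' \<in> pverts D. d_pair D p w w'))"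

definition d_surjection :: "'a pair_pre_digraph \<Rightarrow> 'a \<Rightarrow> 'a \<Rightarrow> bool" where
  "d_surjection D u v \<longleftrightarrow> d_function D u v \<and>
     (\<forall>w' \<in> pverts D. d_subset D w' v \<longrightarrow> (\<exists>p \<in> elems D u. \<exists>w \<in> pverts D. d_pair D p w w'))"

definition cantor :: "'a pair_pre_digraph \<Rightarrow> bool" where
  "cantor D \<longleftrightarrow> \<not> (\<exists>u \<in> pverts D. \<exists>v \<in> pverts D. d_surjection D v u)"

end

theory Submission
  imports Defs
begin

section \<open>Formula trees of the expansions\<close>

text \<open>The formula transcribes "no vertex is a surjection from u to P(u)" clause by clause; the
  work is to show that textual expansion preserves this meaning. Each expansion is the word of a
  tree \<open>fm_q\<close> with variables as parameters, because replacing parameters in the word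
  amounts to changing the parameters of the tree (\<open>replace_word_of\<close>,
  \<open>E9_eq\<close>).

  Along the scheme, \<open>sat_SUS\<close> to \<open>sat_SUR\<close> then show that each tree
  expresses its notion in the digraph, provided that no parameter is captured. The scheme guarantees
  this: each shortcut binds larger indices than all earlier ones and passes to them only its own
  variables and parameters. Unique readability carries the result from trees to words, and the
  letters are counted by unfolding the tree.\<close>

definition fm_SUS :: "var \<Rightarrow> var \<Rightarrow> fm" where
  "fm_SUS x y = FForall 1 (FImp (FElem (X 1) x) (FElem (X 1) y))"
definition fm_SI :: "var \<Rightarrow> var \<Rightarrow> fm" where
  "fm_SI x y = FForall 2 (FIff (FElem (X 2) x) (FEqual (X 2) y))"
definition fm_SIN :: "var \<Rightarrow> var \<Rightarrow> fm" where
  "fm_SIN x y = FForall 3 (FIff (fm_SI (X 3) y) (FEqual (X 3) x))"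
definition fm_DO :: "var \<Rightarrow> var \<Rightarrow> var \<Rightarrow> fm" where
  "fm_DO x y z = FForall 4 (FIff (FElem (X 4) x) (FDisj (FEqual (X 4) y) (FEqual (X 4) z)))"
definition fm_DOU :: "var \<Rightarrow> var \<Rightarrow> var \<Rightarrow> fm" where
  "fm_DOU x y z = FForall 5 (FIff (fm_DO (X 5) y z) (FEqual (X 5) x))"
definition fm_OPA :: "var \<Rightarrow> var \<Rightarrow> var \<Rightarrow> fm" where
  "fm_OPA x y z = FExists 6 (FExists 7
     (FConj (fm_DOU x (X 6) (X 7)) (FConj (fm_SIN (X 6) y) (fm_DOU (X 7) y z))))"
definition fm_REL :: "var \<Rightarrow> var \<Rightarrow> fm" where
  "fm_REL x y = FForall 8 (FImp (FElem (X 8) x) (FExists 9 (FExists 10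
     (FConj (fm_OPA (X 8) (X 9) (X 10)) (FConj (FElem (X 9) y) (fm_SUS (X 10) y))))))"
definition fm_FUN :: "var \<Rightarrow> var \<Rightarrow> fm" where
  "fm_FUN x y = FConj (fm_REL x y) (FForall 11 (FImp (FElem (X 11) y)
     (FExists 12 (FForall 13 (FIff (FEqual (X 13) (X 12))
       (FConj (FElem (X 13) x) (FExists 14 (fm_OPA (X 13) (X 11) (X 14)))))))))"
definition fm_SUR :: "var \<Rightarrow> var \<Rightarrow> fm" where
  "fm_SUR x y = FConj (fm_FUN x y) (FForall 15 (FImp (fm_SUS (X 15) y)
     (FExists 16 (FExists 17 (FConj (FElem (X 16) x) (fm_OPA (X 16) (X 17) (X 15)))))))"

lemmas fm_defs = fm_SUS_def fm_SI_def fm_SIN_def fm_DO_def fm_DOU_def fm_OPA_def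
  fm_REL_def fm_FUN_def fm_SUR_def

text \<open>The parameters \<open>Vx\<close>, \<open>Vy\<close>, \<open>Vz\<close> are never bound,
  so replacing letters changes exactly the arguments of the tree. Arbitrary \<open>a\<close>,
  \<open>b\<close>, \<open>c\<close> are allowed: a captured variable is captured in the tree as
  well, which matters only for the semantics.\<close>

lemma replace_word_of:
  "replace [Vx, Vy] [a, b] (word_of (fm_SUS Vx Vy)) = word_of (fm_SUS a b)"
  "replace [Vx, Vy] [a, b] (word_of (fm_SI Vx Vy)) = word_of (fm_SI a b)"
  "replace [Vx, Vy] [a, b] (word_of (fm_SIN Vx Vy)) = word_of (fm_SIN a b)"
  "replace [Vx, Vy, Vz] [a, b, c] (word_of (fm_DO Vx Vy Vz)) = word_of (fm_DO a b c)"
  "replace [Vx, Vy, Vz] [a, b, c] (word_of (fm_DOU Vx Vy Vz)) = word_of (fm_DOU a b c)"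
  "replace [Vx, Vy, Vz] [a, b, c] (word_of (fm_OPA Vx Vy Vz)) = word_of (fm_OPA a b c)"
  "replace [Vx, Vy] [a, b] (word_of (fm_REL Vx Vy)) = word_of (fm_REL a b)"
  "replace [Vx, Vy] [a, b] (word_of (fm_FUN Vx Vy)) = word_of (fm_FUN a b)"
  "replace [Vx, Vy] [a, b] (word_of (fm_SUR Vx Vy)) = word_of (fm_SUR a b)"
  by (simp_all add: replace_def fm_defs)

lemma expand_Nil [simp]: "expand \<rho> [] = []"
  and expand_Cons [simp]: "expand \<rho> (l # u) = expand_letter \<rho> l @ expand \<rho> u"
  by (simp_all add: expand_def)

text \<open>Folding each expansion back into its tree keeps the computation of the next one small.\<close>

lemma expand_SUS:
  "expand \<rho> (\<^bold>\<forall>1 (X 1 \<^bold>\<in> Vx \<^bold>\<rightarrow> X 1 \<^bold>\<in> Vy)) = word_of (fm_SUS Vx Vy)"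
  by (simp add: replace_word_of fm_SUS_def[of Vx Vy])

lemma expand_SI:
  "expand \<rho> (\<^bold>\<forall>2 (X 2 \<^bold>\<in> Vx \<^bold>\<leftrightarrow> X 2 \<^bold>= Vy)) = word_of (fm_SI Vx Vy)"
  by (simp add: replace_word_of fm_SI_def[of Vx Vy])

lemma expand_SIN:
  "\<rho> SI = Some ([Vx, Vy], word_of (fm_SI Vx Vy)) \<Longrightarrow>
   expand \<rho> (\<^bold>\<forall>3 (atom SI [X 3, Vy] \<^bold>\<leftrightarrow> X 3 \<^bold>= Vx)) = word_of (fm_SIN Vx Vy)"
  \<comment> \<open>Instantiating the definition at \<open>Vx Vy\<close> opens only the outer tree;
    the inserted \<open>fm_SI (X 3) Vy\<close> stays folded on both sides.\<close>
  by (simp add: replace_word_of fm_SIN_def[of Vx Vy])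

lemma expand_DO:
  "expand \<rho> (\<^bold>\<forall>4 (X 4 \<^bold>\<in> Vx \<^bold>\<leftrightarrow> (X 4 \<^bold>= Vy \<^bold>\<or> X 4 \<^bold>= Vz))) = word_of (fm_DO Vx Vy Vz)"
  by (simp add: replace_word_of fm_DO_def[of Vx Vy Vz])

lemma expand_DOU:
  "\<rho> DO = Some ([Vx, Vy, Vz], word_of (fm_DO Vx Vy Vz)) \<Longrightarrow>
   expand \<rho> (\<^bold>\<forall>5 (atom DO [X 5, Vy, Vz] \<^bold>\<leftrightarrow> X 5 \<^bold>= Vx)) = word_of (fm_DOU Vx Vy Vz)"
  by (simp add: replace_word_of fm_DOU_def[of Vx Vy Vz])

lemma expand_OPA:
  "\<rho> SIN = Some ([Vx, Vy], word_of (fm_SIN Vx Vy)) \<Longrightarrow>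
   \<rho> DOU = Some ([Vx, Vy, Vz], word_of (fm_DOU Vx Vy Vz)) \<Longrightarrow>
   expand \<rho> (\<^bold>\<exists>6 (\<^bold>\<exists>7 (atom DOU [Vx, X 6, X 7] \<^bold>\<and> (atom SIN [X 6, Vy] \<^bold>\<and> atom DOU [X 7, Vy, Vz]))))
     = word_of (fm_OPA Vx Vy Vz)"
  by (simp add: replace_word_of fm_OPA_def[of Vx Vy Vz])

lemma expand_REL:
  "\<rho> SUS = Some ([Vx, Vy], word_of (fm_SUS Vx Vy)) \<Longrightarrow>
   \<rho> OPA = Some ([Vx, Vy, Vz], word_of (fm_OPA Vx Vy Vz)) \<Longrightarrow>
   expand \<rho> (\<^bold>\<forall>8 (X 8 \<^bold>\<in> Vx \<^bold>\<rightarrow>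
     (\<^bold>\<exists>9 (\<^bold>\<exists>10 (atom OPA [X 8, X 9, X 10] \<^bold>\<and> (X 9 \<^bold>\<in> Vy \<^bold>\<and> atom SUS [X 10, Vy]))))))
     = word_of (fm_REL Vx Vy)"
  by (simp add: replace_word_of fm_REL_def[of Vx Vy])

lemma expand_FUN:
  "\<rho> REL = Some ([Vx, Vy], word_of (fm_REL Vx Vy)) \<Longrightarrow>
   \<rho> OPA = Some ([Vx, Vy, Vz], word_of (fm_OPA Vx Vy Vz)) \<Longrightarrow>
   expand \<rho> (atom REL [Vx, Vy] \<^bold>\<and>
     (\<^bold>\<forall>11 (X 11 \<^bold>\<in> Vy \<^bold>\<rightarrow>
       (\<^bold>\<exists>12 (\<^bold>\<forall>13 (X 13 \<^bold>= X 12 \<^bold>\<leftrightarrow>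
         (X 13 \<^bold>\<in> Vx \<^bold>\<and> (\<^bold>\<exists>14 (atom OPA [X 13, X 11, X 14])))))))))
     = word_of (fm_FUN Vx Vy)"
  by (simp add: replace_word_of fm_FUN_def[of Vx Vy])

lemma expand_SUR:
  "\<rho> FUN = Some ([Vx, Vy], word_of (fm_FUN Vx Vy)) \<Longrightarrow>
   \<rho> SUS = Some ([Vx, Vy], word_of (fm_SUS Vx Vy)) \<Longrightarrow>
   \<rho> OPA = Some ([Vx, Vy, Vz], word_of (fm_OPA Vx Vy Vz)) \<Longrightarrow>
   expand \<rho> (atom FUN [Vx, Vy] \<^bold>\<and>
     (\<^bold>\<forall>15 (atom SUS [X 15, Vy] \<^bold>\<rightarrow>
       (\<^bold>\<exists>16 (\<^bold>\<exists>17 (X 16 \<^bold>\<in> Vx \<^bold>\<and> atom OPA [X 16, X 17, X 15]))))))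
     = word_of (fm_SUR Vx Vy)"
  by (simp add: replace_word_of fm_SUR_def[of Vx Vy])

lemmas expand_rhs = expand_SUS expand_SI expand_SIN expand_DO expand_DOU expand_OPA
  expand_REL expand_FUN expand_SUR

lemma E9_eq: "E9 = word_of (fm_SUR Vx Vy)"
  unfolding E9_def U0_def expansions_from.simps
  \<comment> \<open>The lookup premises of \<open>expand_rhs\<close> are solved by evaluating the
    updated environments; the restricted simp set keeps \<open>word_of\<close> from spelling out the
    trees.\<close>
  by (simp only: expand_rhs fun_upd_apply predicate.distinct predicate.simps if_True if_False
      refl last.simps list.distinct)

definition fm_cantor :: fm where
  "fm_cantor = FForall 18 (FNeg (FExists 19 (fm_SUR (X 19) (X 18))))"

lemma cantor_formula_eq: "cantor_formula = word_of fm_cantor"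
  by (simp add: cantor_formula_def fm_cantor_def E9_eq replace_word_of)

lemma satisfies_word_of [simp]: "satisfies D f (word_of p) \<longleftrightarrow> sat D f p"
  using inj_word_of by (auto simp: satisfies_def dest: injD)


section \<open>Meaning of the expansions\<close>

text \<open>
  The parameters must avoid the bound variables of the expansion (\<open>X k\<close> up to the given index):
  textual replacement would otherwise capture them.
\<close>

definition above :: "nat \<Rightarrow> var \<Rightarrow> bool" where
  "above n x \<longleftrightarrow> (\<forall>i \<le> n. x \<noteq> X i)"

text \<open>Reduces freshness of the set variables passed to nested atoms to comparing
  indices.\<close>

lemma above_X [simp]: "above n (X i) \<longleftrightarrow> n < i"
  by (auto simp: above_def not_le[symmetric])

lemma above_neq: "above n x \<Longrightarrow> i \<le> n \<Longrightarrow> x \<noteq> X i"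
  by (auto simp: above_def)

lemma above_mono: "above n x \<Longrightarrow> m \<le> n \<Longrightarrow> above m x"
  by (auto simp: above_def)

lemma sat_SUS:
  assumes "above 1 x" "above 1 y"
  shows "sat D f (fm_SUS x y) \<longleftrightarrow> d_subset D (f x) (f y)"
  using assms[THEN above_neq, of 1] by (auto simp: fm_SUS_def d_subset_def elems_def)

text \<open>The quantifier ranges over vertices only, so \<open>f y\<close> must be a vertex for the
  formula to put it into \<open>elems D (f x)\<close>.\<close>

lemma sat_SI:
  assumes "above 2 x" "above 2 y" "f y \<in> pverts D"
  shows "sat D f (fm_SI x y) \<longleftrightarrow> elems D (f x) = {f y}"
  using assms(3) assms(1,2)[THEN above_neq, of 2] by (auto simp: fm_SI_def elems_def)

text \<open>One equivalence yields both halves of the notion: taking the vertex \<open>f x\<close>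
  for \<open>X 3\<close> gives its element set, and the other vertices give uniqueness.
  \<open>sat_DOU\<close> works alike.\<close>

lemma sat_SIN:
  assumes "above 3 x" "above 3 y" "f x \<in> pverts D" "f y \<in> pverts D"
  shows "sat D f (fm_SIN x y) \<longleftrightarrow> d_singleton D (f x) (f y)"
proof -
  have "sat D (f(X 3 := v)) (fm_SI (X 3) y) \<longleftrightarrow> elems D v = {f y}" for v
    using sat_SI[of "X 3" y "f(X 3 := v)" D] assms above_mono[of 3 y 2] above_neq[of 3 y 3] by simp
  then show ?thesis
    using assms above_neq[of 3 x 3] by (auto simp: fm_SIN_def d_singleton_def)
qed

lemma sat_DO:
  assumes "above 4 x" "above 4 y" "above 4 z" "f y \<in> pverts D" "f z \<in> pverts D"
  shows "sat D f (fm_DO x y z) \<longleftrightarrow> elems D (f x) = {f y, f z}"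
  using assms(4,5) assms(1-3)[THEN above_neq, of 4] by (auto simp: fm_DO_def elems_def)

lemma sat_DOU:
  assumes "above 5 x" "above 5 y" "above 5 z"
    and "f x \<in> pverts D" "f y \<in> pverts D" "f z \<in> pverts D"
  shows "sat D f (fm_DOU x y z) \<longleftrightarrow> d_doubleton D (f x) (f y) (f z)"
proof -
  have "sat D (f(X 5 := v)) (fm_DO (X 5) y z) \<longleftrightarrow> elems D v = {f y, f z}" for v
    using sat_DO[of "X 5" y z "f(X 5 := v)" D] assms above_mono[of 5 _ 4] above_neq[of 5 _ 5] by simp
  then show ?thesis
    using assms above_neq[of 5 x 5] by (auto simp: fm_DOU_def d_doubleton_def)
qed

lemma sat_OPA:
  assumes "above 7 x" "above 7 y" "above 7 z"
    and "f x \<in> pverts D" "f y \<in> pverts D" "f z \<in> pverts D"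
  shows "sat D f (fm_OPA x y z) \<longleftrightarrow> d_pair D (f x) (f y) (f z)"
  using assms above_neq[of 7 _ 6] above_neq[of 7 _ 7] above_mono[of 7 _ 5] above_mono[of 7 _ 3]
  by (auto simp: fm_OPA_def d_pair_def sat_DOU sat_SIN)

text \<open>All arguments of the pair atom are bound by quantifiers over vertices, which supplies
  the vertex hypotheses of \<open>sat_OPA\<close>.\<close>

lemma sat_REL:
  assumes "above 10 x" "above 10 y"
  shows "sat D f (fm_REL x y) \<longleftrightarrow> d_relation D (f x) (f y)"
  using assms above_neq[of 10 _ 8] above_neq[of 10 _ 9] above_neq[of 10 _ 10] above_mono[of 10 _ 1]
  by (auto simp: fm_REL_def d_relation_def elems_def sat_OPA sat_SUS)

lemma sat_FUN:
  assumes "above 14 x" "above 14 y"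
  shows "sat D f (fm_FUN x y) \<longleftrightarrow> d_function D (f x) (f y)"
proof -
  \<comment> \<open>This is how the formula expresses unique existence with \<open>X 12\<close> and
    \<open>X 13\<close>.\<close>
  have ex1: "(\<exists>v\<in>V. \<forall>u\<in>V. u = v \<longleftrightarrow> P u) \<longleftrightarrow> (\<exists>!u. u \<in> V \<and> P u)" for V :: "'a set" and P
    by metis
  \<comment> \<open>Unfolding \<open>elems\<close> leaves unbounded quantifiers; this restores the
    bounded form produced by \<open>sat\<close>.\<close>
  have ball: "(\<forall>u. u \<in> V \<and> P u \<longrightarrow> Q u) \<longleftrightarrow> (\<forall>u\<in>V. P u \<longrightarrow> Q u)" for V :: "'a set" and P Q
    by blast
  show ?thesis
    using assms above_neq[of 14 _ 11] above_neq[of 14 _ 12] above_neq[of 14 _ 13]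
      above_neq[of 14 _ 14] above_mono[of 14 _ 10]
    by (simp add: fm_FUN_def d_function_def elems_def sat_REL sat_OPA ex1 ball conj_assoc)
qed

lemma sat_SUR:
  assumes "above 17 x" "above 17 y"
  shows "sat D f (fm_SUR x y) \<longleftrightarrow> d_surjection D (f x) (f y)"
  using assms above_neq[of 17 _ 15] above_neq[of 17 _ 16] above_neq[of 17 _ 17]
    above_mono[of 17 _ 14] above_mono[of 17 _ 1]
  by (auto simp: fm_SUR_def d_surjection_def elems_def Bex_def sat_FUN sat_SUS sat_OPA)

lemma sat_cantor: "sat D f fm_cantor \<longleftrightarrow> cantor D"
  by (simp add: fm_cantor_def cantor_def sat_SUR)

lemma models_cantor_formula:
  assumes "is_digraph D"
  shows "models D cantor_formula \<longleftrightarrow> cantor D"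
proof -
  \<comment> \<open>A constant assignment at some vertex keeps \<open>models\<close> from holding
    vacuously.\<close>
  from assms obtain v where "v \<in> pverts D"
    by (auto simp: is_digraph_def)
  then have "range (\<lambda>_ :: var. v) \<subseteq> pverts D"
    by auto
  then show ?thesis
    by (auto simp: models_def cantor_formula_eq sat_cantor)
qed

theorem theorem5p12:
  shows "cantor_formula \<in> lists zf_alphabet
    \<and> length cantor_formula = 494
    \<and> count_list cantor_formula Neg = 1
    \<and> (\<forall>D :: 'a pair_pre_digraph. is_digraph D \<longrightarrow> (models D cantor_formula \<longleftrightarrow> cantor D))"
proof (intro conjI allI impI)
  show "cantor_formula \<in> lists zf_alphabet"
    by (simp add: cantor_formula_eq fm_cantor_def fm_defs zf_alphabet_def)
  \<comment> \<open>The only \<open>FNeg\<close> is the one in \<open>fm_cantor\<close>.\<close>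
  show "length cantor_formula = 494" "count_list cantor_formula Neg = 1"
    by (simp_all add: cantor_formula_eq fm_cantor_def fm_defs)
qed (rule models_cantor_formula)

end
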